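(* The nonnegative rank of a nonnegative tridiagonal $n\times n$ real matrix can be computed within $O(n)$ arithmetic operations.
   Context: The nonnegative rank of a nonnegative real matrix $X$ is the least $r$ such that $X=YZ$ with $Y,Z$ nonnegative real matrices of inner dimension $r$ (the zero matrix has nonnegative rank $0$). A square matrix $M$ is tridiagonal if $M_{ij}=0$ whenever $|i-j|>1$. *)

theory Defs
  imports "Jordan_Normal_Form.Matrix" "HOL-Library.Landau_Symbols"
begin

definition nonneg_matrix :: "real mat \<Rightarrow> bool" where
  "nonneg_matrix X \<longleftrightarrow> (\<forall>i<dim_row X. \<forall>j<dim_col X. 0 \<le> X $$ (i, j))"

definition tridiagonal :: "real mat \<Rightarrow> bool" where
  "tridiagonal X \<longleftrightarrow> square_mat X \<and>
     (\<forall>i<dim_row X. \<forall>j<dim_col X. \<bar>int i - int j\<bar> > 1 \<longrightarrow> X $$ (i, j) = 0)"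

text \<open>Inner dimension 0 is allowed and yields the zero matrix. The set of admissible \<open>r\<close> is
  nonempty whenever \<open>X\<close> is nonnegative.\<close>

definition nonneg_rank :: "real mat \<Rightarrow> nat" where
  "nonneg_rank X = (LEAST r. \<exists>Y Z. Y \<in> carrier_mat (dim_row X) r \<and> Z \<in> carrier_mat r (dim_col X) \<and>
     nonneg_matrix Y \<and> nonneg_matrix Z \<and> X = Y * Z)"

lemma nonneg_rank_zero: "nonneg_rank (0\<^sub>m n m) = 0"
proof -
  have "0\<^sub>m n m = 0\<^sub>m n 0 * (0\<^sub>m 0 m :: real mat)"
    by (intro eq_matI) (auto simp: scalar_prod_def)
  moreover have "nonneg_matrix (0\<^sub>m n 0)" "nonneg_matrix (0\<^sub>m 0 m)"
    by (auto simp: nonneg_matrix_def)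
  ultimately have "\<exists>Y Z. Y \<in> carrier_mat n 0 \<and> Z \<in> carrier_mat 0 m \<and>
     nonneg_matrix Y \<and> nonneg_matrix Z \<and> 0\<^sub>m n m = Y * Z"
    by (intro exI[of _ "0\<^sub>m n 0"] exI[of _ "0\<^sub>m 0 m"]) auto
  then show ?thesis
    unfolding nonneg_rank_def by (intro Least_eq_0) simp
qed

text \<open>The model of computation is a unit-cost real random access machine, programmed in a structured
  imperative language. It has two unbounded memories, one holding natural numbers (for indices,
  counters and the result) and one holding real numbers, both with indirect addressing. The input
  matrix can only be read, one entry at a time. Index arithmetic is limited to addition and
  truncated subtraction, and there is no conversion from reals to naturals, so that real numbers
  influence the control flow only through comparisons. The constants available in a program are
  integers.\<close>

record ram_state =
  imem :: "nat \<Rightarrow> nat"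
  rmem :: "nat \<Rightarrow> real"

datatype iexp =
    IConst nat
  | IMem iexp
  | IAdd iexp iexp
  | ISub iexp iexp

datatype rexp =
    RConst int
  | RMem iexp
  | Entry iexp iexp
  | RAdd rexp rexp
  | RSub rexp rexp
  | RMul rexp rexp
  | RDiv rexp rexp

datatype bexp =
    ILess iexp iexp
  | RLess rexp rexp
  | Not bexp
  | And bexp bexp

datatype prog =
    Skip
  | ISet iexp iexp
  | RSet iexp rexp
  | Seq prog prog
  | If bexp prog prog
  | While bexp prog

fun ival :: "iexp \<Rightarrow> ram_state \<Rightarrow> nat" where
  "ival (IConst k) s = k"
| "ival (IMem a) s = imem s (ival a s)"
| "ival (IAdd a b) s = ival a s + ival b s"
| "ival (ISub a b) s = ival a s - ival b s"

text \<open>Rows and columns are indexed from 0; reading outside the matrix yields 0, as does division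
  by 0 (which a program can detect by comparisons anyway).\<close>

fun rval :: "real mat \<Rightarrow> rexp \<Rightarrow> ram_state \<Rightarrow> real" where
  "rval X (RConst k) s = of_int k"
| "rval X (RMem a) s = rmem s (ival a s)"
| "rval X (Entry a b) s =
     (let i = ival a s; j = ival b s in if i < dim_row X \<and> j < dim_col X then X $$ (i, j) else 0)"
| "rval X (RAdd a b) s = rval X a s + rval X b s"
| "rval X (RSub a b) s = rval X a s - rval X b s"
| "rval X (RMul a b) s = rval X a s * rval X b s"
| "rval X (RDiv a b) s = rval X a s / rval X b s"

fun bval :: "real mat \<Rightarrow> bexp \<Rightarrow> ram_state \<Rightarrow> bool" where
  "bval X (ILess a b) s \<longleftrightarrow> ival a s < ival b s"
| "bval X (RLess a b) s \<longleftrightarrow> rval X a s < rval X b s"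
| "bval X (Not b) s \<longleftrightarrow> \<not> bval X b s"
| "bval X (And b c) s \<longleftrightarrow> bval X b s \<and> bval X c s"

text \<open>Every constant, memory access, arithmetic operation on reals or indices, comparison and logical
  connective costs one step.\<close>

fun icost :: "iexp \<Rightarrow> nat" where
  "icost (IConst k) = 1"
| "icost (IMem a) = icost a + 1"
| "icost (IAdd a b) = icost a + icost b + 1"
| "icost (ISub a b) = icost a + icost b + 1"

fun rcost :: "rexp \<Rightarrow> nat" where
  "rcost (RConst k) = 1"
| "rcost (RMem a) = icost a + 1"
| "rcost (Entry a b) = icost a + icost b + 1"
| "rcost (RAdd a b) = rcost a + rcost b + 1"
| "rcost (RSub a b) = rcost a + rcost b + 1"
| "rcost (RMul a b) = rcost a + rcost b + 1"
| "rcost (RDiv a b) = rcost a + rcost b + 1"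

fun bcost :: "bexp \<Rightarrow> nat" where
  "bcost (ILess a b) = icost a + icost b + 1"
| "bcost (RLess a b) = rcost a + rcost b + 1"
| "bcost (Not b) = bcost b + 1"
| "bcost (And b c) = bcost b + bcost c + 1"

text \<open>\<open>exec X p s t s'\<close>: on input matrix \<open>X\<close> and initial state \<open>s\<close>, the program \<open>p\<close> terminates
  after exactly \<open>t\<close> steps in state \<open>s'\<close>. Since the definition is inductive, diverging runs are
  not related to any \<open>t\<close> and \<open>s'\<close>.\<close>

inductive exec :: "real mat \<Rightarrow> prog \<Rightarrow> ram_state \<Rightarrow> nat \<Rightarrow> ram_state \<Rightarrow> bool" for X where
  Skip: "exec X Skip s 1 s"
| ISet: "exec X (ISet a e) s (icost a + icost e + 1)
     (s\<lparr>imem := (imem s)(ival a s := ival e s)\<rparr>)"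
| RSet: "exec X (RSet a e) s (icost a + rcost e + 1)
     (s\<lparr>rmem := (rmem s)(ival a s := rval X e s)\<rparr>)"
| Seq: "exec X p s t s' \<Longrightarrow> exec X q s' t' s'' \<Longrightarrow> exec X (Seq p q) s (t + t') s''"
| IfTrue: "bval X b s \<Longrightarrow> exec X p s t s' \<Longrightarrow> exec X (If b p q) s (bcost b + t) s'"
| IfFalse: "\<not> bval X b s \<Longrightarrow> exec X q s t s' \<Longrightarrow> exec X (If b p q) s (bcost b + t) s'"
| WhileFalse: "\<not> bval X b s \<Longrightarrow> exec X (While b p) s (bcost b) s"
| WhileTrue: "bval X b s \<Longrightarrow> exec X p s t s' \<Longrightarrow> exec X (While b p) s' t' s'' \<Longrightarrow>
     exec X (While b p) s (bcost b + t + t') s''"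

inductive_cases SkipE: "exec X Skip s t s'"
inductive_cases ISetE: "exec X (ISet a e) s t s'"
inductive_cases RSetE: "exec X (RSet a e) s t s'"
inductive_cases SeqE: "exec X (Seq p q) s t s'"
inductive_cases IfE: "exec X (If b p q) s t s'"
inductive_cases WhileE: "exec X (While b p) s t s'"

lemma exec_deterministic:
  "exec X p s t s' \<Longrightarrow> exec X p s u s'' \<Longrightarrow> u = t \<and> s'' = s'"
proof (induction arbitrary: u s'' rule: exec.induct)
  case Skip then show ?case by (auto elim: SkipE)
next
  case ISet then show ?case by (auto elim: ISetE)
next
  case RSet then show ?case by (auto elim: RSetE)
next
  case Seq from Seq.prems show ?case by (rule SeqE) (use Seq.IH in blast)
next
  case IfTrue from IfTrue.prems show ?case by (rule IfE) (use IfTrue in blast)+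
next
  case IfFalse from IfFalse.prems show ?case by (rule IfE) (use IfFalse in blast)+
next
  case WhileFalse from WhileFalse.prems show ?case by (rule WhileE) (use WhileFalse in blast)+
next
  case WhileTrue from WhileTrue.prems show ?case by (rule WhileE) (use WhileTrue in blast)+
qed

text \<open>Initially, index cell 0 contains the size of the (square) input and all other cells are 0.
  The result is read off from index cell 0 upon termination.\<close>

definition initial_state :: "nat \<Rightarrow> ram_state" where
  "initial_state n = \<lparr>imem = (\<lambda>_. 0)(0 := n), rmem = (\<lambda>_. 0)\<rparr>"

definition computes_within ::
  "prog \<Rightarrow> (nat \<Rightarrow> real mat set) \<Rightarrow> (real mat \<Rightarrow> nat) \<Rightarrow> (nat \<Rightarrow> nat) \<Rightarrow> bool" where
  "computes_within p inputs f T \<longleftrightarrow>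
     (\<forall>n. \<forall>X \<in> inputs n. \<exists>t s. exec X p (initial_state n) t s \<and> t \<le> T n \<and> imem s 0 = f X)"

end

theory Submission
  imports Defs
begin

text \<open>A nonnegative rank-one matrix below a tridiagonal one lives in a single row, in a single column,
  or in a block \<open>{i, i + 1} \<times> {i, i + 1}\<close>. So a factorization chooses some rows and columns, and the
  remaining entries must be matched exactly by blocks: a run of consecutive blocks is forced by
  \<open>q' = b c / (a - q)\<close>, where \<open>q\<close> is the part of the diagonal entry \<open>a\<close> used by the previous block,
  \<open>b\<close> and \<open>c\<close> are the next off-diagonal entries and \<open>q'\<close> is the part used of the next diagonal entry. A run
  saves one summand compared with taking all rows only if it ends with \<open>q = a\<close>. Whenever a run fails
  or ends, a new one starts as soon as possible from \<open>q = 0\<close>; since at any time at most one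
  run is worth following, a left-to-right scan with bounded memory finds the optimum.\<close>

section \<open>Sums of nonnegative rank-one matrices\<close>

definition nn_decomp :: "nat \<Rightarrow> (nat \<Rightarrow> nat \<Rightarrow> real) \<Rightarrow> bool" where
  "nn_decomp r D \<longleftrightarrow> (\<exists>y z. (\<forall>k<r. \<forall>i. 0 \<le> y k i \<and> 0 \<le> z k i) \<and>
     (\<forall>i j. D i j = (\<Sum>k<r. y k i * z k j)))"

lemma nn_decomp_0: "nn_decomp 0 (\<lambda>i j. 0)"
  by (simp add: nn_decomp_def)

lemma nn_decomp_Suc:
  assumes "nn_decomp r D" "\<And>i. 0 \<le> u i" "\<And>j. 0 \<le> v j" "\<And>i j. E i j = D i j + u i * v j"
  shows "nn_decomp (Suc r) E"
proof -
  obtain y z where yz: "\<forall>k<r. \<forall>i. 0 \<le> y k i \<and> 0 \<le> z k i"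
    "\<And>i j. D i j = (\<Sum>k<r. y k i * z k j)"
    using assms(1) by (auto simp: nn_decomp_def)
  show ?thesis
    unfolding nn_decomp_def
    using assms(2-4) yz
    by (intro exI[of _ "y(r := u)"] exI[of _ "z(r := v)"]) (auto simp: less_Suc_eq)
qed

text \<open>Zero extension frees the scan from the size of the matrix and agrees with what the
  machine reads outside it.\<close>

definition padded :: "real mat \<Rightarrow> nat \<Rightarrow> nat \<Rightarrow> real" where
  "padded X i j = (if i < dim_row X \<and> j < dim_col X then X $$ (i, j) else 0)"

lemma factorization_iff_nn_decomp:
  "(\<exists>Y Z. Y \<in> carrier_mat (dim_row X) r \<and> Z \<in> carrier_mat r (dim_col X) \<and>
     nonneg_matrix Y \<and> nonneg_matrix Z \<and> X = Y * Z) \<longleftrightarrow> nn_decomp r (padded X)"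
proof
  assume "\<exists>Y Z. Y \<in> carrier_mat (dim_row X) r \<and> Z \<in> carrier_mat r (dim_col X) \<and>
     nonneg_matrix Y \<and> nonneg_matrix Z \<and> X = Y * Z"
  then obtain Y Z where YZ: "Y \<in> carrier_mat (dim_row X) r" "Z \<in> carrier_mat r (dim_col X)"
    "nonneg_matrix Y" "nonneg_matrix Z" and X: "X = Y * Z"
    by blast
  have entry: "X $$ (i, j) = (\<Sum>k<r. Y $$ (i, k) * Z $$ (k, j))"
    if "i < dim_row X" "j < dim_col X" for i j
  proof -
    have "(Y * Z) $$ (i, j) = (\<Sum>k<r. Y $$ (i, k) * Z $$ (k, j))"
      using YZ(1,2) that by (auto simp: scalar_prod_def lessThan_atLeast0 intro!: sum.cong)
    then show ?thesis using X by simp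
  qed
  show "nn_decomp r (padded X)"
    unfolding nn_decomp_def
  proof (intro exI conjI allI impI)
    show "0 \<le> (if i < dim_row X then Y $$ (i, k) else 0)" if "k < r" for k i
      using YZ that by (auto simp: nonneg_matrix_def)
    show "0 \<le> (if i < dim_col X then Z $$ (k, i) else 0)" if "k < r" for k i
      using YZ that by (auto simp: nonneg_matrix_def)
    show "padded X i j = (\<Sum>k<r. (if i < dim_row X then Y $$ (i, k) else 0) *
        (if j < dim_col X then Z $$ (k, j) else 0))" for i j
      by (auto simp: padded_def entry)
  qed
next
  assume "nn_decomp r (padded X)"
  then obtain y z where yz: "\<forall>k<r. \<forall>i. 0 \<le> y k i \<and> 0 \<le> z k i"
    "\<And>i j. padded X i j = (\<Sum>k<r. y k i * z k j)"
    by (auto simp: nn_decomp_def)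
  let ?Y = "mat (dim_row X) r (\<lambda>(i, k). y k i)" and ?Z = "mat r (dim_col X) (\<lambda>(k, j). z k j)"
  have "X = ?Y * ?Z"
  proof (rule eq_matI)
    fix i j assume ij: "i < dim_row (?Y * ?Z)" "j < dim_col (?Y * ?Z)"
    then have "(?Y * ?Z) $$ (i, j) = (\<Sum>k<r. y k i * z k j)"
      by (auto simp: scalar_prod_def lessThan_atLeast0 intro!: sum.cong)
    with ij show "X $$ (i, j) = (?Y * ?Z) $$ (i, j)"
      using yz(2)[of i j] by (simp add: padded_def)
  qed auto
  moreover have "nonneg_matrix ?Y" "nonneg_matrix ?Z"
    using yz(1) by (auto simp: nonneg_matrix_def)
  ultimately show "\<exists>Y Z. Y \<in> carrier_mat (dim_row X) r \<and> Z \<in> carrier_mat r (dim_col X) \<and>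
     nonneg_matrix Y \<and> nonneg_matrix Z \<and> X = Y * Z"
    by (intro exI[of _ ?Y] exI[of _ ?Z]) auto
qed

lemma nonneg_rank_eqI:
  assumes "nn_decomp k (padded X)" "\<And>r. nn_decomp r (padded X) \<Longrightarrow> k \<le> r"
  shows "nonneg_rank X = k"
  unfolding nonneg_rank_def factorization_iff_nn_decomp
  using assms by (intro Least_equality)

section \<open>The scan\<close>

text \<open>In state \<open>(m, x, k)\<close> at index \<open>i\<close>, mode \<open>Square\<close> means that \<open>k\<close> summands produce the leading
  block up to \<open>i\<close> with its last diagonal entry replaced by \<open>x\<close>. In the other modes no exact run is
  alive and \<open>k + 1\<close> summands produce the rows up to \<open>i\<close> (\<open>Row\<close>), the columns up to \<open>i\<close> (\<open>Col\<close>),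
  each of the two (\<open>Line\<close>), or the union of these rows and columns (\<open>Cross\<close>); \<open>x\<close> is then
  irrelevant.\<close>

datatype mode = Square | Cross | Line | Row | Col

text \<open>Once \<open>x = M i i\<close>, a further block has diagonal entry 0 at \<open>i\<close>
  and degenerates, so a positive off-diagonal entry is left to column \<open>Suc i\<close> (upper)
  or row \<open>Suc i\<close> (lower). Outside \<open>Square\<close>, rows up to \<open>i\<close>
  miss only the lower entry, columns only the upper one, and \<open>Line\<close> may choose; a run
  restarts from 0 as soon as nothing is missed, and the pending summand is then counted.\<close>

definition step :: "(nat \<Rightarrow> nat \<Rightarrow> real) \<Rightarrow> nat \<Rightarrow> mode \<times> real \<times> nat \<Rightarrow> mode \<times> real \<times> nat" where
  "step M i = (\<lambda>(m, x, k).
     if m = Square then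
       if x < M i i then
         (if M i (Suc i) * M (Suc i) i / (M i i - x) \<le> M (Suc i) (Suc i) then Square else Line,
          M i (Suc i) * M (Suc i) i / (M i i - x), Suc k)
       else if 0 < M i (Suc i) then
         if 0 < M (Suc i) i then (Cross, x, Suc k) else (Col, x, k)
       else
         if 0 < M (Suc i) i then (Row, x, k) else (Square, 0, k)
     else if m \<noteq> Cross \<and> (0 < M (Suc i) i \<or> m = Col) \<and> (0 < M i (Suc i) \<or> m = Row)
     then (m, x, Suc k)
     else (Square, 0, Suc k))"

fun scan :: "(nat \<Rightarrow> nat \<Rightarrow> real) \<Rightarrow> nat \<Rightarrow> mode \<times> real \<times> nat" where
  "scan M 0 = (Square, 0, 0)"
| "scan M (Suc i) = step M i (scan M i)"

locale tridiag =
  fixes M :: "nat \<Rightarrow> nat \<Rightarrow> real"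
  assumes nonneg: "0 \<le> M i j"
    and band: "Suc i < j \<or> Suc j < i \<Longrightarrow> M i j = 0"
begin

section \<open>Upper bound\<close>

definition corner :: "nat \<Rightarrow> real \<Rightarrow> nat \<Rightarrow> nat \<Rightarrow> real" where
  "corner n x i j = (if i = n \<and> j = n then x else if i \<le> n \<and> j \<le> n then M i j else 0)"

definition rows :: "nat \<Rightarrow> nat \<Rightarrow> nat \<Rightarrow> real" where
  "rows n i j = (if i \<le> n then M i j else 0)"

definition cols :: "nat \<Rightarrow> nat \<Rightarrow> nat \<Rightarrow> real" where
  "cols n i j = (if j \<le> n then M i j else 0)"

definition cross :: "nat \<Rightarrow> nat \<Rightarrow> nat \<Rightarrow> real" where
  "cross n i j = (if i \<le> n \<or> j \<le> n then M i j else 0)"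

lemma rows_Suc: "nn_decomp k (rows n) \<Longrightarrow> nn_decomp (Suc k) (rows (Suc n))"
  by (erule nn_decomp_Suc[where u = "\<lambda>i. if i = Suc n then 1 else 0" and v = "M (Suc n)"])
    (auto simp: rows_def nonneg le_Suc_eq)

lemma cols_Suc: "nn_decomp k (cols n) \<Longrightarrow> nn_decomp (Suc k) (cols (Suc n))"
  by (erule nn_decomp_Suc[where v = "\<lambda>i. if i = Suc n then 1 else 0" and u = "\<lambda>i. M i (Suc n)"])
    (auto simp: cols_def nonneg le_Suc_eq)

lemma below_diag_0: "M (Suc n) n = 0 \<Longrightarrow> i \<le> n \<Longrightarrow> n < j \<Longrightarrow> M j i = 0"
  by (cases "j = Suc n \<and> i = n") (auto intro!: band)

lemma above_diag_0: "M n (Suc n) = 0 \<Longrightarrow> i \<le> n \<Longrightarrow> n < j \<Longrightarrow> M i j = 0"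
  by (cases "j = Suc n \<and> i = n") (auto intro!: band)

text \<open>Row \<open>Suc n\<close> of the left-hand side holds only \<open>M (Suc n) n\<close>; if
  this vanishes, finished rows are the start of a fresh run.\<close>

lemma corner_Suc_0_rows: "M (Suc n) n = 0 \<Longrightarrow> corner (Suc n) 0 = rows n"
  by (intro ext) (auto simp: corner_def rows_def le_Suc_eq below_diag_0 intro!: band)

lemma corner_Suc_0_cols: "M n (Suc n) = 0 \<Longrightarrow> corner (Suc n) 0 = cols n"
  by (intro ext) (auto simp: corner_def cols_def le_Suc_eq above_diag_0 intro!: band)

lemma corner_Suc_0_cross: "corner (Suc n) 0 = cross n"
  by (intro ext) (auto simp: corner_def cross_def le_Suc_eq intro!: band)

lemma corner_full_rows: "M n (Suc n) = 0 \<Longrightarrow> corner n (M n n) = rows n"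
  by (intro ext) (auto simp: corner_def rows_def above_diag_0)

lemma corner_full_cols: "M (Suc n) n = 0 \<Longrightarrow> corner n (M n n) = cols n"
  by (intro ext) (auto simp: corner_def cols_def below_diag_0)

lemma corner_rows:
  assumes "nn_decomp k (corner n x)" "x \<le> M n n"
  shows "nn_decomp (Suc k) (rows n)"
  by (rule nn_decomp_Suc[OF assms(1), where u = "\<lambda>i. if i = n then 1 else 0"
        and v = "\<lambda>j. if j = n then M n n - x else if j = Suc n then M n j else 0"])
    (use assms(2) in \<open>auto simp: corner_def rows_def nonneg intro!: band\<close>)

lemma corner_cols:
  assumes "nn_decomp k (corner n x)" "x \<le> M n n"
  shows "nn_decomp (Suc k) (cols n)"
  by (rule nn_decomp_Suc[OF assms(1), where v = "\<lambda>i. if i = n then 1 else 0"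
        and u = "\<lambda>i. if i = n then M n n - x else if i = Suc n then M i n else 0"])
    (use assms(2) in \<open>auto simp: corner_def cols_def nonneg intro!: band\<close>)

lemma corner_full_cross:
  assumes "nn_decomp k (corner n (M n n))"
  shows "nn_decomp (Suc (Suc k)) (cross (Suc n))"
proof -
  have "nn_decomp (Suc k) (\<lambda>i j. if j = Suc n then M i j else corner n (M n n) i j)"
    by (rule nn_decomp_Suc[OF assms, where v = "\<lambda>j. if j = Suc n then 1 else 0"
          and u = "\<lambda>i. M i (Suc n)"]) (auto simp: corner_def nonneg)
  then show ?thesis
    \<comment> \<open>Column \<open>Suc n\<close> already supplies the common diagonal entry, so the
      row summand has 0 there.\<close>
    by (rule nn_decomp_Suc[where u = "\<lambda>i. if i = Suc n then 1 else 0"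
          and v = "\<lambda>j. if j = Suc n then 0 else M (Suc n) j"])
      (auto simp: corner_def cross_def nonneg intro!: band)
qed

text \<open>The new block supplies the rest \<open>M n n - x\<close> of the diagonal entry and both
  off-diagonal entries; rank one then forces its last entry to be the quotient used by the
  scan.\<close>

lemma corner_Suc:
  assumes "nn_decomp k (corner n x)" "x < M n n"
  shows "nn_decomp (Suc k) (corner (Suc n) (M n (Suc n) * M (Suc n) n / (M n n - x)))"
  by (rule nn_decomp_Suc[OF assms(1),
        where u = "\<lambda>i. if i = n then 1 else if i = Suc n then M i n / (M n n - x) else 0"
        and v = "\<lambda>j. if j = n then M n n - x else if j = Suc n then M n j else 0"])
    (use assms(2) in \<open>auto simp: corner_def nonneg intro!: band\<close>)

definition realised :: "nat \<Rightarrow> mode \<times> real \<times> nat \<Rightarrow> bool" where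
  "realised i = (\<lambda>(m, x, k). case m of
     Square \<Rightarrow> 0 \<le> x \<and> x \<le> M i i \<and> nn_decomp k (corner i x)
   | Cross \<Rightarrow> nn_decomp (Suc k) (cross i)
   | Line \<Rightarrow> nn_decomp (Suc k) (rows i) \<and> nn_decomp (Suc k) (cols i)
   | Row \<Rightarrow> nn_decomp (Suc k) (rows i)
   | Col \<Rightarrow> nn_decomp (Suc k) (cols i))"

lemma realised_step:
  assumes "realised i (m, x, k)"
  shows "realised (Suc i) (step M i (m, x, k))"
proof -
  have pos: "M p q = 0" if "\<not> 0 < M p q" for p q
    using that nonneg[of p q] by simp
  show ?thesis
  proof (cases m)
    case Square
    then have x: "0 \<le> x" "x \<le> M i i" and k: "nn_decomp k (corner i x)"
      using assms by (auto simp: realised_def)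
    show ?thesis
    proof (cases "x < M i i")
      case True
      then show ?thesis
        using Square corner_Suc[OF k True] rows_Suc[OF corner_rows[OF k x(2)]]
          cols_Suc[OF corner_cols[OF k x(2)]]
        by (auto simp: step_def realised_def nonneg)
    next
      case False
      then have "x = M i i" using x by simp
      with k have k': "nn_decomp k (corner i (M i i))" by simp
      show ?thesis
        using Square False corner_full_cross[OF k'] k' corner_full_rows[of i] corner_full_cols[of i]
          rows_Suc[of k i] cols_Suc[of k i] corner_Suc_0_cols[of i] pos
        by (auto simp: step_def realised_def nonneg)
    qed
  next
    case Cross
    then show ?thesis
      using assms by (auto simp: step_def realised_def nonneg corner_Suc_0_cross)
  next
    case Line
    then show ?thesis
      using assms rows_Suc cols_Suc corner_Suc_0_rows[of i] corner_Suc_0_cols[of i] pos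
      by (auto simp: step_def realised_def nonneg)
  next
    case Row
    then show ?thesis
      using assms rows_Suc corner_Suc_0_rows[of i] pos
      by (auto simp: step_def realised_def nonneg)
  next
    case Col
    then show ?thesis
      using assms cols_Suc corner_Suc_0_cols[of i] pos
      by (auto simp: step_def realised_def nonneg)
  qed
qed

lemma realised_scan: "realised i (scan M i)"
proof (induction i)
  case 0
  have "corner 0 0 = (\<lambda>i j. 0)" by (intro ext) (auto simp: corner_def)
  then show ?case by (simp add: realised_def nonneg nn_decomp_0)
next
  case (Suc i)
  then show ?case using realised_step by (cases "scan M i") simp
qed

section \<open>Lower bound\<close>

text \<open>Here \<open>\<alpha>\<close> and \<open>\<beta>\<close> are the numbers of summands in row and in column \<open>i\<close> of an arbitrary
  decomposition, \<open>q\<close> is the contribution of the block \<open>{i - 1, i}\<close> to the diagonal entry \<open>i\<close>, and \<open>w\<close>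
  counts the summands met so far. Only a decomposition following the run of the scan exactly may be
  cheaper than \<open>k + 1\<close>.\<close>

definition dominated :: "mode \<times> real \<times> nat \<Rightarrow> nat \<Rightarrow> nat \<Rightarrow> real \<Rightarrow> nat \<Rightarrow> bool" where
  "dominated = (\<lambda>(m, x, k) \<alpha> \<beta> q w.
     (0 < \<alpha> \<and> 0 < \<beta> \<longrightarrow> k + (if m = Cross then 1 else 2) \<le> w) \<and>
     (0 < \<alpha> \<and> \<beta> = 0 \<longrightarrow> k + (if m = Col then 2 else 1) \<le> w) \<and>
     (\<alpha> = 0 \<and> 0 < \<beta> \<longrightarrow> k + (if m = Row then 2 else 1) \<le> w) \<and>
     (\<alpha> = 0 \<and> \<beta> = 0 \<longrightarrow> k + 1 \<le> w \<or> m = Square \<and> q = x \<and> k \<le> w))"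

text \<open>The block \<open>{i, i + 1}\<close> receives \<open>\<sigma>\<close> summands, with total diagonal entries \<open>p\<close>, \<open>q'\<close> and
  off-diagonal entries \<open>u\<close>, \<open>v\<close>. No constraint is needed for \<open>\<sigma> \<ge> 2\<close>, which costs as much as
  covering both rows.\<close>

lemma dominated_step:
  fixes p q q' u v :: real and \<sigma> :: nat
  assumes dom: "dominated (m, x, k) \<alpha> \<beta> q w"
    and p: "0 \<le> p" and q': "\<alpha>' = 0 \<Longrightarrow> \<beta>' = 0 \<Longrightarrow> q' \<le> M (Suc i) (Suc i)"
    and diag: "\<alpha> = 0 \<Longrightarrow> \<beta> = 0 \<Longrightarrow> M i i = q + p"
    and upper: "\<alpha> = 0 \<Longrightarrow> \<beta>' = 0 \<Longrightarrow> M i (Suc i) = u"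
    and lower: "\<alpha>' = 0 \<Longrightarrow> \<beta> = 0 \<Longrightarrow> M (Suc i) i = v"
    and none: "\<sigma> = 0 \<Longrightarrow> p = 0 \<and> q' = 0 \<and> u = 0 \<and> v = 0"
    and one: "\<sigma> = 1 \<Longrightarrow> p * q' = u * v"
  shows "dominated (step M i (m, x, k)) \<alpha>' \<beta>' q' (w + \<alpha>' + \<beta>' + \<sigma>)"
proof -
  have B: "\<sigma> \<noteq> 0" if "\<alpha> = 0" "\<beta>' = 0" "0 < M i (Suc i)" using that upper none by auto
  have C: "\<sigma> \<noteq> 0" if "\<alpha>' = 0" "\<beta> = 0" "0 < M (Suc i) i" using that lower none by auto
  have q'_0: "q' = 0" if "\<sigma> = 0" using that none by simp
  have "m = Square \<and> x < M i i \<or> m = Square \<and> \<not> x < M i i \<or> m \<noteq> Square" by blast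
  then show ?thesis
  proof (elim disjE conjE)
    assume m: "m = Square" and x: "x < M i i"
    define y where "y = M i (Suc i) * M (Suc i) i / (M i i - x)"
    have exact: "\<alpha> = 0 \<and> \<beta> = 0 \<and> q = x \<and> k \<le> w" if "w \<le> k"
      using dom m that by (cases "\<alpha> = 0"; cases "\<beta> = 0") (auto simp: dominated_def)
    have p_pos: "0 < p" if "\<alpha> = 0" "\<beta> = 0" "q = x" using diag that x by simp
    have w: "Suc k \<le> w + \<sigma>"
      using exact p_pos none by (cases "\<sigma> = 0"; cases "w \<le> k") auto
    \<comment> \<open>If \<open>w \<le> k\<close>, the decomposition follows the run with one block,
      and rank one gives the value. Otherwise \<open>w = k + 1\<close> and there is no block, so one
      of the off-diagonal entries is 0, and \<open>q'\<close> and \<open>y\<close> both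
      vanish.\<close>
    have q'_eq: "q' = y" if ab': "\<alpha>' = 0" "\<beta>' = 0" and small: "w + \<sigma> < k + 2"
    proof (cases "w \<le> k")
      case True
      then have "\<alpha> = 0" "\<beta> = 0" "q = x" "\<sigma> = 1" using exact w small by auto
      then show ?thesis
        using one upper lower diag p_pos ab' x by (auto simp: y_def field_simps)
    next
      case False
      then have "\<sigma> = 0" using small by simp
      moreover have "\<alpha> = 0 \<or> \<beta> = 0" using dom m small by (auto simp: dominated_def)
      ultimately show ?thesis using none upper lower ab' by (auto simp: y_def)
    qed
    have "step M i (m, x, k) = (if y \<le> M (Suc i) (Suc i) then Square else Line, y, Suc k)"
      using m x by (simp add: step_def y_def)
    \<comment> \<open>In mode \<open>Line\<close>, \<open>y\<close> exceeds the diagonal entry, so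
      without lines at \<open>Suc i\<close> the value \<open>q' = y\<close> is impossible and the
      weight is at least \<open>k + 2\<close>.\<close>
    then show ?thesis
      using w q'_eq q' by (cases "w + \<sigma> < k + 2") (auto simp: dominated_def)
  next
    assume m: "m = Square" and x: "\<not> x < M i i"
    have exact: "\<alpha> = 0 \<and> \<beta> = 0 \<and> k \<le> w \<and> (\<sigma> = 1 \<longrightarrow> u * v = 0)" if "w \<le> k"
    proof -
      have "\<alpha> = 0" "\<beta> = 0" "q = x" "k \<le> w"
        using dom m that by (cases "\<alpha> = 0"; cases "\<beta> = 0"; auto simp: dominated_def)+
      moreover from this have "p = 0" using diag p x by simp
      ultimately show ?thesis using one by auto
    qed
    have two: "\<alpha> = 0 \<or> \<beta> = 0 \<or> k + 2 \<le> w" using dom m by (auto simp: dominated_def)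
    have w: "k \<le> w" using exact by linarith
    have wB: "k + 1 \<le> w + \<sigma>" if "\<beta>' = 0" "0 < M i (Suc i)"
      using B[OF _ that] exact by (cases "w \<le> k") auto
    have wC: "k + 1 \<le> w + \<sigma>" if "\<alpha>' = 0" "0 < M (Suc i) i"
      using C[OF that(1) _ that(2)] exact by (cases "w \<le> k") auto
    \<comment> \<open>Following the run exactly leaves \<open>p = 0\<close>, so a lone block has
      \<open>u * v = 0\<close> and cannot supply two positive entries.\<close>
    have wBC: "k + 2 \<le> w + \<sigma>"
      if that': "\<alpha>' = 0" "\<beta>' = 0" "0 < M i (Suc i)" "0 < M (Suc i) i"
    proof (cases "w \<le> k")
      case True
      then have "\<sigma> \<noteq> 1" using exact upper lower that' by auto
      moreover have "\<sigma> \<noteq> 0" using exact[OF True] B that' by blast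
      ultimately show ?thesis using w by linarith
    next
      case False
      have "\<sigma> \<noteq> 0 \<or> k + 2 \<le> w" using two B C that' by blast
      with False show ?thesis by linarith
    qed
    have w0: "q' = 0 \<or> k + 1 \<le> w + \<sigma>" using q'_0 w by (cases "\<sigma> = 0") auto
    consider "0 < M i (Suc i)" "0 < M (Suc i) i" "step M i (m, x, k) = (Cross, x, Suc k)"
      | "0 < M i (Suc i)" "step M i (m, x, k) = (Col, x, k)"
      | "0 < M (Suc i) i" "step M i (m, x, k) = (Row, x, k)"
      | "step M i (m, x, k) = (Square, 0, k)"
      using m x by (cases "0 < M i (Suc i)"; cases "0 < M (Suc i) i") (simp_all add: step_def)
    then show ?thesis
    proof cases
      case 1
      show ?thesis
        unfolding 1 using w wB[OF _ 1(1)] wC[OF _ 1(2)] wBC[OF _ _ 1(1,2)]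
        by (auto simp: dominated_def)
    next
      case 2
      show ?thesis
        unfolding 2 using w wB[OF _ 2(1)] by (auto simp: dominated_def)
    next
      case 3
      show ?thesis
        unfolding 3 using w wC[OF _ 3(1)] by (auto simp: dominated_def)
    next
      case 4
      show ?thesis
        unfolding 4 using w w0 by (auto simp: dominated_def)
    qed
  next
    assume m: "m \<noteq> Square"
    have w: "k + 1 \<le> w"
      using dom m
      by (cases "\<alpha> = 0"; cases "\<beta> = 0") (auto simp: dominated_def split: if_splits)
    have two: "m = Cross \<or> \<alpha> = 0 \<or> \<beta> = 0 \<or> k + 2 \<le> w"
      using dom by (auto simp: dominated_def)
    have row: "k + 2 \<le> w" if "m = Row" "\<beta> \<noteq> 0"
      using dom that by (cases "\<alpha> = 0") (auto simp: dominated_def)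
    have col: "k + 2 \<le> w" if "m = Col" "\<alpha> \<noteq> 0"
      using dom that by (cases "\<beta> = 0") (auto simp: dominated_def)
    have w0: "k + 2 \<le> w + \<sigma>" if "\<sigma> \<noteq> 0 \<or> k + 2 \<le> w" using that w by linarith
    consider (wait) "m \<noteq> Cross" "0 < M (Suc i) i \<or> m = Col" "0 < M i (Suc i) \<or> m = Row"
        "step M i (m, x, k) = (m, x, Suc k)"
      | (restart) "step M i (m, x, k) = (Square, 0, Suc k)"
      using m
      by (cases "m \<noteq> Cross \<and> (0 < M (Suc i) i \<or> m = Col) \<and> (0 < M i (Suc i) \<or> m = Row)")
        (simp_all add: step_def)
    then show ?thesis
    proof cases
      case wait
      \<comment> \<open>At weight \<open>k + 1\<close> the lines at \<open>i\<close> are of one kind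
        at most, in \<open>Row\<close> or \<open>Col\<close> only the kind so named; a positive
        entry they miss demands a block.\<close>
      have "k + 2 \<le> w + \<sigma>" if "\<alpha>' = 0" "\<beta>' = 0"
        using w0 two row col B C that wait(1-3) by blast
      moreover have "k + 2 \<le> w + \<sigma>" if "m = Col" "\<beta>' = 0"
        using w0 col B that wait(3) by blast
      moreover have "k + 2 \<le> w + \<sigma>" if "m = Row" "\<alpha>' = 0"
        using w0 row C that wait(2) by blast
      ultimately show ?thesis
        unfolding wait(4) using w wait(1) by (auto simp: dominated_def)
    next
      case restart
      \<comment> \<open>Without a block nothing of the next diagonal entry is used, as in a run
        restarted from 0; with one, the weight reaches \<open>k + 2\<close>.\<close>
      show ?thesis
        unfolding restart using w q'_0 by (cases "\<sigma> = 0") (auto simp: dominated_def)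
    qed
  qed
qed

end

section \<open>Supports of rank-one summands, and counting them\<close>

datatype shape = In_row nat | In_col nat | In_square nat

fun fits :: "shape \<Rightarrow> (nat \<Rightarrow> real) \<Rightarrow> (nat \<Rightarrow> real) \<Rightarrow> bool" where
  "fits (In_row i) y z \<longleftrightarrow> (\<forall>a. y a \<noteq> 0 \<longrightarrow> a = i)"
| "fits (In_col i) y z \<longleftrightarrow> (\<forall>a. z a \<noteq> 0 \<longrightarrow> a = i)"
| "fits (In_square i) y z \<longleftrightarrow> (\<forall>a. y a \<noteq> 0 \<or> z a \<noteq> 0 \<longrightarrow> a = i \<or> a = Suc i)"

lemma two_nonzeros:
  fixes y :: "nat \<Rightarrow> real"
  assumes "\<nexists>i. \<forall>a. y a \<noteq> 0 \<longrightarrow> a = i"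
  obtains a b where "a < b" "y a \<noteq> 0" "y b \<noteq> 0"
  using assms by (metis nat_neq_iff)

text \<open>If neither vector is supported on a single index, two indices \<open>a < a'\<close> and
  \<open>b < b'\<close> from the supports satisfy \<open>a' \<le> Suc b\<close> and
  \<open>b' \<le> Suc a\<close>, so both pairs are the same neighbours, and they confine every other
  index.\<close>

lemma fits_exists:
  assumes "\<And>a b. y a \<noteq> 0 \<Longrightarrow> z b \<noteq> 0 \<Longrightarrow> a \<le> Suc b \<and> b \<le> Suc a"
  shows "\<exists>s. fits s y z"
proof (cases "(\<exists>i. \<forall>a. y a \<noteq> 0 \<longrightarrow> a = i) \<or> (\<exists>i. \<forall>a. z a \<noteq> 0 \<longrightarrow> a = i)")
  case True
  then show ?thesis by (metis fits.simps(1,2))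
next
  case False
  obtain a a' where a: "a < a'" "y a \<noteq> 0" "y a' \<noteq> 0" using False two_nonzeros[of y] by metis
  obtain b b' where b: "b < b'" "z b \<noteq> 0" "z b' \<noteq> 0" using False two_nonzeros[of z] by metis
  have "a' \<le> Suc b" "b' \<le> Suc a" using assms a b by auto
  then have eq: "a = b" "a' = Suc a" "b' = Suc b" using a(1) b(1) by auto
  have "fits (In_square a) y z"
    unfolding fits.simps
  proof (intro allI impI)
    fix c assume "y c \<noteq> 0 \<or> z c \<noteq> 0"
    then have "c \<le> Suc a" "Suc a \<le> Suc c"
      using assms[of c b] assms[of c b'] assms[of a c] assms[of a' c] a b eq by auto
    then show "c = a \<or> c = Suc a" by linarith
  qed
  then show ?thesis by blast
qed

context tridiag
begin

lemma scan_le: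
  assumes "nn_decomp r M"
  shows "snd (snd (scan M n)) \<le> r"
proof -
  obtain y z where nonneg_yz: "\<And>k i. k < r \<Longrightarrow> 0 \<le> y k i \<and> 0 \<le> z k i"
    and M: "\<And>i j. M i j = (\<Sum>k<r. y k i * z k j)"
    using assms by (auto simp: nn_decomp_def)
  have "\<exists>s. fits s (y k) (z k)" if k: "k < r" for k
  proof (rule fits_exists)
    fix a b assume "y k a \<noteq> 0" "z k b \<noteq> 0"
    then have "0 < y k a * z k b" using nonneg_yz[OF k] by (simp add: order_less_le)
    also have "\<dots> \<le> M a b"
      unfolding M using k nonneg_yz by (intro member_le_sum) auto
    finally show "a \<le> Suc b \<and> b \<le> Suc a" using band[of a b] by force
  qed
  then obtain t where t: "\<And>k. k < r \<Longrightarrow> fits (t k) (y k) (z k)" by metis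
  \<comment> \<open>Several shapes may fit a summand; fixing one for each makes these classes
    disjoint, so that no summand is counted twice.\<close>
  define F where "F s = {k. k < r \<and> t k = s}" for s
  have F_fits: "fits s (y k) (z k)" if "k \<in> F s" for k s using that t by (auto simp: F_def)
  have F_sub: "F s \<subseteq> {..<r}" for s by (auto simp: F_def)
  have fin: "finite (F s)" for s using F_sub finite_subset by blast
  define \<alpha> \<beta> \<sigma> where "\<alpha> i = card (F (In_row i))" and "\<beta> i = card (F (In_col i))"
    and "\<sigma> i = card (F (In_square i))" for i
  define e where "e h i j = (\<Sum>k\<in>F (In_square h). y k i * z k j)" for h i j
  define q where "q i = (case i of 0 \<Rightarrow> 0 | Suc h \<Rightarrow> e h i i)" for i
  \<comment> \<open>The block starting at \<open>i\<close> is not met yet, hence the strict bound in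
    the second sum.\<close>
  define W where "W i = (\<Sum>j\<le>i. \<alpha> j + \<beta> j) + (\<Sum>j<i. \<sigma> j)" for i
  have e_nonneg: "0 \<le> e h i j" for h i j
    unfolding e_def using nonneg_yz F_sub by (intro sum_nonneg mult_nonneg_nonneg) auto
  have e_le: "e h i j \<le> M i j" for h i j
    unfolding e_def M using F_sub nonneg_yz by (intro sum_mono2 mult_nonneg_nonneg) auto
  have shape: "t k = In_row i \<or> t k = In_col j \<or>
      (\<exists>h. t k = In_square h \<and> i \<in> {h, Suc h} \<and> j \<in> {h, Suc h})"
    if "k < r" "y k i * z k j \<noteq> 0" for k i j
    using t[OF that(1)] that(2) by (cases "t k") auto
  have F_empty: "k \<notin> F s" if "card (F s) = 0" for k s using that fin[of s] by auto
  have off: "M i j = e h i j"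
    if "\<alpha> i = 0" "\<beta> j = 0" "(i, j) \<in> {(h, Suc h), (Suc h, h)}" for h i j
    unfolding M e_def
  proof (rule sum.mono_neutral_right)
    show "\<forall>k\<in>{..<r} - F (In_square h). y k i * z k j = 0"
    proof (intro ballI, rule ccontr)
      fix k assume k: "k \<in> {..<r} - F (In_square h)" and "y k i * z k j \<noteq> 0"
      then show False
        using shape[of k i j] that F_empty[of _ k] by (auto simp: \<alpha>_def \<beta>_def F_def)
    qed
  qed (use F_sub in auto)
  have diag: "M i i = q i + e i i i" if ab: "\<alpha> i = 0" "\<beta> i = 0" for i
  proof (cases i)
    case 0
    have "M i i = e i i i"
      unfolding M e_def
    proof (rule sum.mono_neutral_right)
      show "\<forall>k\<in>{..<r} - F (In_square i). y k i * z k i = 0"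
      proof (intro ballI, rule ccontr)
        fix k assume k: "k \<in> {..<r} - F (In_square i)" and "y k i * z k i \<noteq> 0"
        then show False
          using shape[of k i i] ab 0 F_empty[of _ k] by (auto simp: \<alpha>_def \<beta>_def F_def)
      qed
    qed (use F_sub in auto)
    then show ?thesis by (simp add: q_def 0)
  next
    case (Suc h)
    have "M i i = (\<Sum>k\<in>F (In_square h) \<union> F (In_square i). y k i * z k i)"
      unfolding M
    proof (rule sum.mono_neutral_right)
      show "\<forall>k\<in>{..<r} - (F (In_square h) \<union> F (In_square i)). y k i * z k i = 0"
      proof (intro ballI, rule ccontr)
        fix k assume k: "k \<in> {..<r} - (F (In_square h) \<union> F (In_square i))"
          and "y k i * z k i \<noteq> 0"
        then show False
          using shape[of k i i] ab Suc F_empty[of _ k] by (auto simp: \<alpha>_def \<beta>_def F_def)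
      qed
    qed (use F_sub in auto)
    also have "\<dots> = e h i i + e i i i"
      unfolding e_def using fin Suc by (intro sum.union_disjoint) (auto simp: F_def)
    finally show ?thesis by (simp add: q_def Suc)
  qed
  have none: "e i i i = 0 \<and> q (Suc i) = 0 \<and> e i i (Suc i) = 0 \<and> e i (Suc i) i = 0"
    if "\<sigma> i = 0" for i
  proof -
    have "F (In_square i) = {}" using that fin by (auto simp: \<sigma>_def)
    then show ?thesis by (simp add: e_def q_def)
  qed
  \<comment> \<open>A single summand has rank one, so its block has determinant 0.\<close>
  have one: "e i i i * q (Suc i) = e i i (Suc i) * e i (Suc i) i" if "\<sigma> i = 1" for i
  proof -
    obtain k where "F (In_square i) = {k}"
      using \<open>\<sigma> i = 1\<close> card_1_singletonE by (auto simp: \<sigma>_def)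
    then show ?thesis by (simp add: e_def q_def)
  qed
  have "dominated (scan M i) (\<alpha> i) (\<beta> i) (q i) (W i)" for i
  proof (induction i)
    case 0
    show ?case by (auto simp: dominated_def W_def q_def)
  next
    case (Suc i)
    obtain m x k where scan: "scan M i = (m, x, k)" by (cases "scan M i")
    have "dominated (step M i (m, x, k)) (\<alpha> (Suc i)) (\<beta> (Suc i)) (q (Suc i))
        (W i + \<alpha> (Suc i) + \<beta> (Suc i) + \<sigma> i)"
    proof (rule dominated_step[where p = "e i i i" and u = "e i i (Suc i)" and v = "e i (Suc i) i"])
      show "dominated (m, x, k) (\<alpha> i) (\<beta> i) (q i) (W i)" using Suc scan by simp
      show "q (Suc i) \<le> M (Suc i) (Suc i)" by (simp add: q_def e_le)
    qed (use diag none one off[of i "Suc i" i] off[of "Suc i" i i] e_nonneg in auto)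
    then show ?case by (simp add: scan W_def algebra_simps)
  qed
  from this[of n] have "snd (snd (scan M n)) \<le> W n"
    by (cases "scan M n") (auto simp: dominated_def split: if_splits)
  also have "W n \<le> r"
  proof -
    let ?S = "In_row ` {..n} \<union> In_col ` {..n} \<union> In_square ` {..<n}"
    have "W n = (\<Sum>s\<in>In_row ` {..n}. card (F s)) + (\<Sum>s\<in>In_col ` {..n}. card (F s)) +
        (\<Sum>s\<in>In_square ` {..<n}. card (F s))"
      by (simp add: W_def \<alpha>_def \<beta>_def \<sigma>_def sum.distrib sum.reindex inj_on_def)
    also have "\<dots> = (\<Sum>s\<in>?S. card (F s))"
      by (subst sum.union_disjoint; (subst sum.union_disjoint)?) auto
    also have "\<dots> = card (\<Union>s\<in>?S. F s)"
      using fin by (intro card_UN_disjoint[symmetric]) (auto simp: F_def)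
    also have "\<dots> \<le> card {..<r}"
      using F_sub by (intro card_mono) auto
    finally show ?thesis by simp
  qed
  finally show ?thesis .
qed

text \<open>Reading one row and column of zeros past the matrix forces a restart, so the final diagonal
  entry needs no special treatment.\<close>

lemma fst_scan_after:
  assumes "\<And>i j. n \<le> i \<or> n \<le> j \<Longrightarrow> M i j = 0"
  shows "fst (scan M n) = Square"
proof (cases n)
  case (Suc i)
  obtain m x k where scan: "scan M i = (m, x, k)" by (cases "scan M i")
  have "M i n = 0" "M n i = 0" "M n n = 0" using assms by auto
  then show ?thesis using Suc scan by (auto simp: step_def)
qed simp

end

section \<open>Straight-line code and counting loops\<close>

fun loop_free :: "prog \<Rightarrow> bool" where
  "loop_free (Seq p q) \<longleftrightarrow> loop_free p \<and> loop_free q"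
| "loop_free (If b p q) \<longleftrightarrow> loop_free p \<and> loop_free q"
| "loop_free (While b p) \<longleftrightarrow> False"
| "loop_free _ \<longleftrightarrow> True"

fun run :: "real mat \<Rightarrow> prog \<Rightarrow> ram_state \<Rightarrow> ram_state" where
  "run X (ISet a e) s = s\<lparr>imem := (imem s)(ival a s := ival e s)\<rparr>"
| "run X (RSet a e) s = s\<lparr>rmem := (rmem s)(ival a s := rval X e s)\<rparr>"
| "run X (Seq p q) s = run X q (run X p s)"
| "run X (If b p q) s = (if bval X b s then run X p s else run X q s)"
| "run X _ s = s"

text \<open>Adding the costs of both branches is coarse, but only independence of the input
  matters.\<close>

fun max_cost :: "prog \<Rightarrow> nat" where
  "max_cost (ISet a e) = icost a + icost e + 1"
| "max_cost (RSet a e) = icost a + rcost e + 1"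
| "max_cost (Seq p q) = max_cost p + max_cost q"
| "max_cost (If b p q) = bcost b + max_cost p + max_cost q"
| "max_cost _ = 1"

lemma exec_loop_free: "loop_free p \<Longrightarrow> \<exists>t\<le>max_cost p. exec X p s t (run X p s)"
proof (induction p arbitrary: s)
  case Skip
  then show ?case by (auto intro!: exI[of _ 1] exec.Skip)
next
  case ISet
  then show ?case by (auto intro: exec.ISet[simplified])
next
  case RSet
  then show ?case by (auto intro: exec.RSet[simplified])
next
  case (Seq p q)
  then obtain t t' where "t \<le> max_cost p" "exec X p s t (run X p s)"
    "t' \<le> max_cost q" "exec X q (run X p s) t' (run X q (run X p s))"
    by (metis loop_free.simps(1))
  then show ?case by (intro exI[of _ "t + t'"]) (auto intro: exec.Seq)
next
  case (If b p q)
  obtain t where t: "t \<le> max_cost p" "exec X p s t (run X p s)" using If by auto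
  obtain t' where t': "t' \<le> max_cost q" "exec X q s t' (run X q s)" using If by auto
  show ?case
  proof (cases "bval X b s")
    case True
    then show ?thesis using t by (intro exI[of _ "bcost b + t"]) (auto intro: exec.IfTrue)
  next
    case False
    then show ?thesis using t' by (intro exI[of _ "bcost b + t'"]) (auto intro: exec.IfFalse)
  qed
qed auto

text \<open>The invariant is indexed by the loop counter, so there are \<open>n - j\<close> rounds
  and one failing test.\<close>

lemma exec_While:
  assumes "loop_free p"
    and "\<And>j s. I j s \<Longrightarrow> bval X b s \<longleftrightarrow> j < n"
    and "\<And>j s. I j s \<Longrightarrow> j < n \<Longrightarrow> I (Suc j) (run X p s)"
    and "I j s" "j \<le> n"
  shows "\<exists>t s'. exec X (While b p) s t s' \<and> I n s' \<and>
    t \<le> (n - j) * (bcost b + max_cost p) + bcost b"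
  using assms(4,5)
proof (induction "n - j" arbitrary: j s)
  case 0
  then have "j = n" "\<not> bval X b s" using assms(2) by auto
  then show ?case using 0 exec.WhileFalse by (metis le_add2)
next
  case (Suc d)
  then have j: "j < n" by simp
  obtain t where t: "t \<le> max_cost p" "exec X p s t (run X p s)"
    using exec_loop_free[OF assms(1)] by blast
  have "d = n - Suc j" "Suc j \<le> n" "I (Suc j) (run X p s)" using Suc assms(3) by auto
  then obtain t' s' where t': "exec X (While b p) (run X p s) t' s'" "I n s'"
    "t' \<le> (n - Suc j) * (bcost b + max_cost p) + bcost b"
    using Suc.hyps(1) by blast
  have "exec X (While b p) s (bcost b + t + t') s'"
    using t t' assms(2)[OF Suc.prems(1)] j by (intro exec.WhileTrue) auto
  moreover have "n - j = Suc (n - Suc j)" using j by simp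
  ultimately show ?case using t t' by (intro exI[of _ "bcost b + t + t'"] exI[of _ s']) auto
qed

section \<open>The program\<close>

text \<open>\<open>Square\<close> is 0, so zero-initialised cells encode the start of the scan. The
  order turns tests on modes into comparisons: above 1 means neither \<open>Square\<close> nor
  \<open>Cross\<close>, not below 4 means \<open>Col\<close>, strictly between 2 and 4 means
  \<open>Row\<close>.\<close>

fun code :: "mode \<Rightarrow> nat" where
  "code Square = 0" | "code Cross = 1" | "code Line = 2" | "code Row = 3" | "code Col = 4"

abbreviation "cell k \<equiv> IMem (IConst k)"
abbreviation "set_cell k e \<equiv> ISet (IConst k) e"
abbreviation "succ_cell k \<equiv> IAdd (cell k) (IConst 1)"
abbreviation "real_cell \<equiv> RMem (IConst 0)"
abbreviation "set_real_cell e \<equiv> RSet (IConst 0) e"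
abbreviation "this_diag \<equiv> Entry (cell 1) (cell 1)"
abbreviation "next_diag \<equiv> Entry (succ_cell 1) (succ_cell 1)"
abbreviation "upper_entry \<equiv> Entry (cell 1) (succ_cell 1)"
abbreviation "lower_entry \<equiv> Entry (succ_cell 1) (cell 1)"
abbreviation "positive e \<equiv> RLess (RConst 0) e"
abbreviation "incr_count \<equiv> set_cell 3 (succ_cell 3)"

text \<open>Index cells 1, 2, 3 hold the index, the mode and the count; real cell 0 holds
  \<open>x\<close>. Negated conjunctions express the disjunctions of \<open>step\<close>.\<close>

definition step_prog :: prog where
  "step_prog =
     If (ILess (cell 2) (IConst 1))
       (If (RLess real_cell this_diag)
         (Seq (set_real_cell (RDiv (RMul upper_entry lower_entry) (RSub this_diag real_cell)))
           (Seq (If (RLess next_diag real_cell) (set_cell 2 (IConst 2)) Skip) incr_count))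
         (If (positive upper_entry)
           (If (positive lower_entry) (Seq (set_cell 2 (IConst 1)) incr_count) (set_cell 2 (IConst 4)))
           (If (positive lower_entry) (set_cell 2 (IConst 3)) (set_real_cell (RConst 0)))))
       (Seq
         (If (And (ILess (IConst 1) (cell 2))
             (And (Not (And (Not (positive lower_entry)) (ILess (cell 2) (IConst 4))))
               (Not (And (Not (positive upper_entry))
                 (Not (And (ILess (IConst 2) (cell 2)) (ILess (cell 2) (IConst 4))))))))
           Skip
           (Seq (set_cell 2 (IConst 0)) (set_real_cell (RConst 0))))
         incr_count)"

definition body :: prog where
  "body = Seq step_prog (set_cell 1 (succ_cell 1))"

definition scan_prog :: prog where
  "scan_prog = Seq (While (ILess (cell 1) (cell 0)) body) (set_cell 0 (cell 3))"

definition encodes :: "real mat \<Rightarrow> nat \<Rightarrow> ram_state \<Rightarrow> bool" where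
  "encodes X j s \<longleftrightarrow> imem s 0 = dim_row X \<and> imem s 1 = j \<and>
     (case scan (padded X) j of (m, x, k) \<Rightarrow> imem s 2 = code m \<and> rmem s 0 = x \<and> imem s 3 = k)"

lemma encodes_body:
  assumes "encodes X j s"
  shows "encodes X (Suc j) (run X body s)"
proof -
  obtain m x k where scan: "scan (padded X) j = (m, x, k)" by (cases "scan (padded X) j")
  \<comment> \<open>This covers the last round too, which reads one row and one column past the
    matrix.\<close>
  have entry: "rval X (Entry a b) s = padded X (ival a s) (ival b s)" for a b s
    by (simp add: padded_def Let_def)
  show ?thesis
    using assms scan
    by (cases m) (auto simp: encodes_def body_def step_prog_def step_def entry simp del: rval.simps(3))
qed

theorem theorem4p4:
  shows "\<exists>(p :: prog) (T :: nat \<Rightarrow> nat).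
    computes_within p
      (\<lambda>n. {X \<in> carrier_mat n n. nonneg_matrix X \<and> tridiagonal X}) nonneg_rank T \<and>
    (\<lambda>n. real (T n)) \<in> O(\<lambda>n. real n)"
proof -
  define c d where "c = bcost (ILess (cell 1) (cell 0)) + max_cost body"
    and "d = bcost (ILess (cell 1) (cell 0)) + (icost (IConst 0) + icost (cell 3) + 1)"
  have "computes_within scan_prog
      (\<lambda>n. {X \<in> carrier_mat n n. nonneg_matrix X \<and> tridiagonal X}) nonneg_rank (\<lambda>n. n * c + d)"
    unfolding computes_within_def
  proof (intro allI ballI)
    fix n X assume "X \<in> {X \<in> carrier_mat n n. nonneg_matrix X \<and> tridiagonal X}"
    then have dim: "dim_row X = n" "dim_col X = n" and nn: "nonneg_matrix X"
      and tri: "tridiagonal X" by auto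
    interpret tridiag "padded X"
      by unfold_locales (use nn tri dim in \<open>auto simp: padded_def nonneg_matrix_def tridiagonal_def\<close>)
    obtain t s where ts: "exec X (While (ILess (cell 1) (cell 0)) body) (initial_state n) t s"
      "encodes X n s" "t \<le> n * c + bcost (ILess (cell 1) (cell 0))"
      using exec_While[of body "encodes X" X "ILess (cell 1) (cell 0)" n 0 "initial_state n"]
        encodes_body[of X] dim
      by (auto simp: c_def encodes_def initial_state_def body_def step_prog_def)
    have zero: "padded X i j = 0" if "n \<le> i \<or> n \<le> j" for i j
      using that dim by (auto simp: padded_def)
    obtain m x k where scan: "scan (padded X) n = (m, x, k)" by (cases "scan (padded X) n")
    have "nonneg_rank X = k"
    proof (rule nonneg_rank_eqI)
      have "m = Square" using fst_scan_after[of n] zero scan by auto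
      then have "x = 0" and *: "nn_decomp k (corner n x)"
        using realised_scan[of n] scan zero[of n n] by (auto simp: realised_def)
      \<comment> \<open>Row and column \<open>n\<close> are zero, so the leading block up to
        \<open>n\<close> is the whole matrix.\<close>
      moreover have "corner n 0 = padded X"
        by (intro ext) (auto simp: corner_def zero)
      ultimately show "nn_decomp k (padded X)" by simp
      show "k \<le> r" if "nn_decomp r (padded X)" for r
        using scan_le[OF that, of n] scan by simp
    qed
    moreover have "imem s 3 = k" using ts(2) scan by (simp add: encodes_def)
    moreover have "exec X scan_prog (initial_state n) (t + (icost (IConst 0) + icost (cell 3) + 1))
        (run X (set_cell 0 (cell 3)) s)"
      unfolding scan_prog_def run.simps by (intro exec.Seq[OF ts(1)] exec.ISet)
    moreover have "t + (icost (IConst 0) + icost (cell 3) + 1) \<le> n * c + d"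
      using ts(3) by (simp add: d_def)
    ultimately show "\<exists>t s. exec X scan_prog (initial_state n) t s \<and> t \<le> n * c + d \<and>
        imem s 0 = nonneg_rank X"
      by (intro exI conjI) auto
  qed
  moreover have "(\<lambda>n. real (n * c + d)) \<in> O(\<lambda>n. real n)"
  proof (rule bigoI[of _ "real (c + d)"], rule eventually_sequentiallyI[of 1])
    fix n :: nat assume "1 \<le> n"
    then have "d * 1 \<le> d * n" by (intro mult_le_mono2)
    then have "n * c + d \<le> (c + d) * n" by (simp add: algebra_simps)
    then show "norm (real (n * c + d)) \<le> real (c + d) * norm (real n)"
      by (metis norm_of_nat of_nat_le_iff of_nat_mult)
  qed
  ultimately show ?thesis by blast
qed

end
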